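(* For a positive integer $n$ let $N_n=\{1,2,\dots,n\}$. Let $Y_n$ be the set of all maps $*:N_n\times N_n\to 2^{N_n}$ which are associative, i.e. such that $(N_n,* )$ is a multisemigroup, and let $Y'_n$ be the set of all maps $*:N_n\times N_n\to 2^{N_n}$ such that $(N_n,* )$ is a hypergroup. Then $$\frac{|Y_n|}{2^{n^3}}\to 1\quad\text{and}\quad \frac{|Y'_n|}{2^{n^3}}\to 1\qquad\text{when } n\to\infty.$$
   Context: A multisemigroup is a pair $(S,* )$ with $S$ a non-empty set and $*:S\times S\to 2^S$ a map (multivalued binary operation) such that $\bigcup_{t\in b*c}a*t=\bigcup_{s\in a*b}s*c$ for all $a,b,c\in S$. A hypergroup is a multisemigroup $(S,* )$ such that $S*a=a*S=S$ for every $a\in S$, where $S*a=\bigcup_{s\in S}s*a$ and $a*S=\bigcup_{s\in S}a*s$. The total number of multivalued binary operations on $N_n$ is $2^{n^3}$. *)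

theory Defs
  imports Complex_Main "HOL-Library.FuncSet"
begin

definition multisemigroup :: "'a set \<Rightarrow> ('a \<times> 'a \<Rightarrow> 'a set) \<Rightarrow> bool" where
  "multisemigroup S m \<longleftrightarrow>
     S \<noteq> {} \<and> m \<in> S \<times> S \<rightarrow> Pow S \<and>
     (\<forall>a\<in>S. \<forall>b\<in>S. \<forall>c\<in>S. (\<Union>t\<in>m (b, c). m (a, t)) = (\<Union>s\<in>m (a, b). m (s, c)))"

definition hypergroup :: "'a set \<Rightarrow> ('a \<times> 'a \<Rightarrow> 'a set) \<Rightarrow> bool" where
  "hypergroup S m \<longleftrightarrow>
     multisemigroup S m \<and>
     (\<forall>a\<in>S. (\<Union>s\<in>S. m (s, a)) = S \<and> (\<Union>s\<in>S. m (a, s)) = S)"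

text \<open>
  The extensional function space represents every map from \<open>S \<times> S\<close> to \<open>Pow S\<close>
  exactly once, so that cardinalities of sets of operations are the intended ones.
\<close>

definition multioperations :: "'a set \<Rightarrow> ('a \<times> 'a \<Rightarrow> 'a set) set" where
  "multioperations S = S \<times> S \<rightarrow>\<^sub>E Pow S"

definition N :: "nat \<Rightarrow> nat set" where
  "N n = {1..n}"

definition Y :: "nat \<Rightarrow> (nat \<times> nat \<Rightarrow> nat set) set" where
  "Y n = {m \<in> multioperations (N n). multisemigroup (N n) m}"

definition Y' :: "nat \<Rightarrow> (nat \<times> nat \<Rightarrow> nat set) set" where
  "Y' n = {m \<in> multioperations (N n). hypergroup (N n) m}"

lemma card_multioperations: "card (multioperations (N n)) = 2 ^ (n ^ 3)"
  by (simp add: multioperations_def N_def card_PiE card_Pow power_mult [symmetric]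
      power3_eq_cube mult.assoc)

end

theory Submission
  imports Defs "HOL-Library.Disjoint_Sets" "HOL-Real_Asymp.Real_Asymp"
begin

text \<open>
  Choose an operation \<open>m\<close> on an \<open>n\<close>-element set \<open>S\<close> uniformly at random, that is, put each
  \<open>t\<close> into each \<open>m x\<close> independently with probability \<open>1/2\<close>. An element \<open>d\<close> is missing from
  \<open>a * (b * c)\<close> only if every \<open>t\<close> violates one of the two conditions \<open>t \<in> b * c\<close> and
  \<open>d \<in> a * t\<close>. Away from \<open>t = d\<close> all these conditions are distinct, both within a pair and
  between different \<open>t\<close>, hence independent, so this has probability at most
  \<open>(3/4) ^ (n - 1)\<close> (\<open>card_never_composing_le\<close>); the same bound holds for \<open>(a * b) * c\<close>. Summing over the \<open>n ^ 4\<close> quadruples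
  \<open>(a, b, c, d)\<close> and the two bracketings shows that, except with probability at most
  \<open>2 n ^ 4 (3/4) ^ (n - 1)\<close>, every triple product, bracketed either way, is all of \<open>S\<close>.

  Such an operation is associative for a trivial reason, since both sides of every instance equal
  \<open>S\<close>, and it is a hypergroup because a full product \<open>a * (b * c)\<close> forces \<open>a * S = S\<close> and a full
  product \<open>(a * b) * c\<close> forces \<open>S * c = S\<close> (\<open>full_triple_products_imp_hypergroup\<close>).
  So already the fraction of hypergroups tends to \<open>1\<close>, and the fraction of multisemigroups lies
  above it.
\<close>

text \<open>
  Membership in disjoint sets is decided independently, and a two-element set \<open>P\<close> excludes one of
  the four possible traces \<open>R \<inter> P\<close>. Each member of the family therefore costs a factor \<open>3/4\<close>.
\<close>
lemma card_subsets_containing_no_pair: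
  assumes "finite C" "finite U" "disjoint C" "\<And>P. P \<in> C \<Longrightarrow> P \<subseteq> U \<and> card P = 2"
  shows "4 ^ card C * card {R. R \<subseteq> U \<and> (\<forall>P\<in>C. \<not> P \<subseteq> R)} = 3 ^ card C * 2 ^ card U"
  using assms
proof (induction C arbitrary: U rule: finite_induct)
  case empty
  then show ?case by (simp add: card_Pow Pow_def [symmetric])
next
  case (insert P C)
  let ?A = "\<lambda>C U. {R. R \<subseteq> U \<and> (\<forall>P\<in>C. \<not> P \<subseteq> R)}"
  have P: "P \<subseteq> U" "card P = 2" "finite P"
    using insert.prems by (auto intro: finite_subset)
  have disj: "Q \<inter> P = {}" if "Q \<in> C" for Q
    using insert.prems(2) insert.hyps(2) that by (auto simp: pairwise_def disjnt_def)
  have "bij_betw (\<lambda>R. (R \<inter> P, R - P)) (?A (insert P C) U) ((Pow P - {P}) \<times> ?A C (U - P))"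
  proof (rule bij_betw_byWitness [where f' = "\<lambda>(T, R). T \<union> R"])
    show "(\<lambda>R. (R \<inter> P, R - P)) ` ?A (insert P C) U \<subseteq> (Pow P - {P}) \<times> ?A C (U - P)"
      by auto
    show "(\<lambda>(T, R). T \<union> R) ` ((Pow P - {P}) \<times> ?A C (U - P)) \<subseteq> ?A (insert P C) U"
    proof (rule image_subsetI)
      fix z assume "z \<in> (Pow P - {P}) \<times> ?A C (U - P)"
      then obtain T R where z: "z = (T, R)"
        and *: "T \<subseteq> P" "T \<noteq> P" "R \<subseteq> U - P" "\<forall>Q\<in>C. \<not> Q \<subseteq> R"
        by auto
      have "\<not> Q \<subseteq> T \<union> R" if "Q \<in> C" for Q
        using *(1,4) disj [OF that] that by blast
      moreover have "\<not> P \<subseteq> T \<union> R" "T \<union> R \<subseteq> U"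
        using *(1-3) P(1) by blast+
      ultimately show "(case z of (T, R) \<Rightarrow> T \<union> R) \<in> ?A (insert P C) U"
        by (simp add: z)
    qed
  qed auto
  then have "card (?A (insert P C) U) = card ((Pow P - {P}) \<times> ?A C (U - P))"
    by (rule bij_betw_same_card)
  also have "\<dots> = 3 * card (?A C (U - P))"
    using P by (simp add: card_cartesian_product card_Pow)
  finally have split: "card (?A (insert P C) U) = 3 * card (?A C (U - P))" .
  have IH: "4 ^ card C * card (?A C (U - P)) = 3 ^ card C * 2 ^ card (U - P)"
    using insert.prems disj by (intro insert.IH) (auto simp: pairwise_insert)
  have "card U = card (U - P) + 2"
    using P insert.prems(1) by (metis add.commute card_Diff_subset card_mono le_add_diff_inverse)
  then have "(2::nat) ^ card U = 4 * 2 ^ card (U - P)"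
    by simp
  then show ?case
    using IH insert.hyps unfolding split by simp
qed

text \<open>
  Membership \<open>t \<in> m x\<close> and membership \<open>d \<in> m (g t)\<close> are read off the set
  \<open>Sigma (S \<times> S) m\<close> of all pairs \<open>(y, t)\<close> with \<open>t \<in> m y\<close>, which determines \<open>m\<close> and must not
  contain both \<open>(x, t)\<close> and \<open>(g t, d)\<close>. With \<open>x = (b, c)\<close> and \<open>g t = (a, t)\<close> the element \<open>d\<close> is
  then missing from \<open>a * (b * c)\<close>, and with \<open>x = (a, b)\<close> and \<open>g t = (t, c)\<close> from \<open>(a * b) * c\<close>.
\<close>
lemma card_never_composing_le:
  assumes fin: "finite S" and x: "x \<in> S \<times> S" and d: "d \<in> S"
    and g: "inj_on g S" "g ` S \<subseteq> S \<times> S"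
  shows "real (card {m \<in> multioperations S. \<forall>t\<in>m x. d \<notin> m (g t)})
           \<le> (3/4) ^ (card S - 1) * 2 ^ (card S ^ 3)"
proof -
  let ?U = "(S \<times> S) \<times> S"
  \<comment> \<open>The value \<open>t = d\<close> is left out because \<open>(x, d)\<close> may coincide with some \<open>(g t, d)\<close>.\<close>
  let ?pair = "\<lambda>t. {(x, t), (g t, d)}"
  let ?C = "?pair ` (S - {d})"
  let ?B = "{m \<in> multioperations S. \<forall>t\<in>m x. d \<notin> m (g t)}"
  let ?A = "{R. R \<subseteq> ?U \<and> (\<forall>P\<in>?C. \<not> P \<subseteq> R)}"
  have inj: "inj_on ?pair (S - {d})"
    by (auto simp: inj_on_def doubleton_eq_iff)
  have cardC: "card ?C = card S - 1"
    using fin d by (simp add: card_image [OF inj])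
  have "disjoint ?C"
    using g(1) by (auto simp: pairwise_def disjnt_def inj_on_def)
  moreover have "P \<subseteq> ?U \<and> card P = 2" if "P \<in> ?C" for P
    using that x d g(2) by (auto simp: card_insert_if)
  ultimately have "4 ^ (card S - 1) * card ?A = 3 ^ (card S - 1) * 2 ^ card ?U"
    using card_subsets_containing_no_pair [of ?C ?U] fin by (simp add: cardC)
  then have "real (4 ^ (card S - 1) * card ?A) = real (3 ^ (card S - 1) * 2 ^ card ?U)"
    by (rule arg_cong)
  then have cardA: "real (card ?A) = (3/4) ^ (card S - 1) * 2 ^ (card S ^ 3)"
    by (simp add: power_divide field_simps card_cartesian_product power3_eq_cube)
  have "inj_on (Sigma (S \<times> S)) ?B"
  proof (rule inj_onI)
    fix m m' assume m: "m \<in> ?B" "m' \<in> ?B" "Sigma (S \<times> S) m = Sigma (S \<times> S) m'"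
    show "m = m'"
    proof (rule PiE_ext [of _ "S \<times> S" "\<lambda>_. Pow S"])
      fix y assume "y \<in> S \<times> S"
      have "m y = Sigma (S \<times> S) m `` {y}" "m' y = Sigma (S \<times> S) m' `` {y}"
        using \<open>y \<in> S \<times> S\<close> by auto
      then show "m y = m' y"
        using m(3) by simp
    qed (use m in \<open>auto simp: multioperations_def\<close>)
  qed
  moreover have "Sigma (S \<times> S) ` ?B \<subseteq> ?A"
    by (fastforce simp: multioperations_def PiE_iff)
  moreover have "finite ?A"
    using fin by (auto intro: finite_subset [of _ "Pow ?U"])
  ultimately have "card ?B \<le> card ?A"
    by (rule card_inj_on_le)
  then show ?thesis
    unfolding cardA [symmetric] by (rule of_nat_mono)
qed

definition full_triple_products :: "'a set \<Rightarrow> ('a \<times> 'a \<Rightarrow> 'a set) \<Rightarrow> bool" where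
  "full_triple_products S m \<longleftrightarrow>
     (\<forall>a\<in>S. \<forall>b\<in>S. \<forall>c\<in>S. (\<Union>t\<in>m (b, c). m (a, t)) = S \<and> (\<Union>s\<in>m (a, b). m (s, c)) = S)"

lemma full_triple_products_imp_hypergroup:
  assumes "S \<noteq> {}" "m \<in> multioperations S" "full_triple_products S m"
  shows "hypergroup S m"
proof -
  have m: "m (a, b) \<subseteq> S" if "a \<in> S" "b \<in> S" for a b
    using assms(2) that by (auto simp: multioperations_def)
  have "(\<Union>s\<in>S. m (s, a)) = S \<and> (\<Union>s\<in>S. m (a, s)) = S" if a: "a \<in> S" for a
  proof -
    have "S = (\<Union>t\<in>m (a, a). m (a, t))" "S = (\<Union>s\<in>m (a, a). m (s, a))"
      using assms(3) a unfolding full_triple_products_def by blast+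
    then have "S \<subseteq> (\<Union>s\<in>S. m (a, s))" "S \<subseteq> (\<Union>s\<in>S. m (s, a))"
      using m [OF a a] by (metis UN_mono subset_refl)+
    moreover have "(\<Union>s\<in>S. m (s, a)) \<subseteq> S" "(\<Union>s\<in>S. m (a, s)) \<subseteq> S"
      by (simp_all add: UN_subset_iff m a)
    ultimately show ?thesis
      by blast
  qed
  moreover have "multisemigroup S m"
    using assms unfolding multisemigroup_def full_triple_products_def multioperations_def
    by (auto simp: PiE_def)
  ultimately show ?thesis
    by (simp add: hypergroup_def)
qed

lemma card_not_full_triple_products_le:
  assumes fin: "finite S"
  shows "real (card {m \<in> multioperations S. \<not> full_triple_products S m})
           \<le> 2 * real (card S) ^ 4 * (3/4) ^ (card S - 1) * 2 ^ (card S ^ 3)"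
proof -
  let ?M = "multioperations S"
  let ?Q = "S \<times> S \<times> S \<times> S"
  let ?L = "\<lambda>(a, b, c, d). {m \<in> ?M. \<forall>t\<in>m (b, c). d \<notin> m (a, t)}"
  let ?R = "\<lambda>(a, b, c, d). {m \<in> ?M. \<forall>s\<in>m (a, b). d \<notin> m (s, c)}"
  let ?e = "(3/4) ^ (card S - 1) * 2 ^ (card S ^ 3) :: real"
  have finM: "finite ?M"
    using fin by (auto simp: multioperations_def intro!: finite_PiE)
  have L: "real (card (?L q)) \<le> ?e" if q: "q \<in> ?Q" for q
  proof -
    obtain a b c d where abcd: "q = (a, b, c, d)" "a \<in> S" "b \<in> S" "c \<in> S" "d \<in> S"
      using q by auto
    show ?thesis
      using card_never_composing_le [OF fin, of "(b, c)" d "\<lambda>t. (a, t)"] abcd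
      by (auto simp: inj_on_def)
  qed
  have R: "real (card (?R q)) \<le> ?e" if q: "q \<in> ?Q" for q
  proof -
    obtain a b c d where abcd: "q = (a, b, c, d)" "a \<in> S" "b \<in> S" "c \<in> S" "d \<in> S"
      using q by auto
    show ?thesis
      using card_never_composing_le [OF fin, of "(a, b)" d "\<lambda>s. (s, c)"] abcd
      by (auto simp: inj_on_def)
  qed
  have "{m \<in> ?M. \<not> full_triple_products S m} \<subseteq> (\<Union>q\<in>?Q. ?L q \<union> ?R q)"
  proof
    fix m assume "m \<in> {m \<in> ?M. \<not> full_triple_products S m}"
    then have m: "m \<in> ?M" "\<not> full_triple_products S m"
      by auto
    have sub: "m (u, v) \<subseteq> S" if "u \<in> S" "v \<in> S" for u v
      using m(1) that by (auto simp: multioperations_def)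
    obtain a b c where abc: "a \<in> S" "b \<in> S" "c \<in> S"
      and ne: "(\<Union>t\<in>m (b, c). m (a, t)) \<noteq> S \<or> (\<Union>s\<in>m (a, b). m (s, c)) \<noteq> S"
      using m(2) unfolding full_triple_products_def by metis
    have "(\<Union>t\<in>m (b, c). m (a, t)) \<subseteq> S" "(\<Union>s\<in>m (a, b). m (s, c)) \<subseteq> S"
      using sub [OF abc(2,3)] sub [OF abc(1,2)] abc by (intro UN_least sub; blast)+
    then obtain d where "d \<in> S" "d \<notin> (\<Union>t\<in>m (b, c). m (a, t)) \<or> d \<notin> (\<Union>s\<in>m (a, b). m (s, c))"
      using ne by blast
    then have "(a, b, c, d) \<in> ?Q" "m \<in> ?L (a, b, c, d) \<union> ?R (a, b, c, d)"
      using abc m(1) by auto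
    then show "m \<in> (\<Union>q\<in>?Q. ?L q \<union> ?R q)"
      by blast
  qed
  moreover have "(\<Union>q\<in>?Q. ?L q \<union> ?R q) \<subseteq> ?M"
    by auto
  ultimately have "card {m \<in> ?M. \<not> full_triple_products S m} \<le> card (\<Union>q\<in>?Q. ?L q \<union> ?R q)"
    using finM by (meson card_mono finite_subset)
  also have "\<dots> \<le> (\<Sum>q\<in>?Q. card (?L q \<union> ?R q))"
    using fin by (intro card_UN_le) auto
  also have "\<dots> \<le> (\<Sum>q\<in>?Q. card (?L q) + card (?R q))"
    by (intro sum_mono card_Un_le)
  finally have "real (card {m \<in> ?M. \<not> full_triple_products S m})
      \<le> real (\<Sum>q\<in>?Q. card (?L q) + card (?R q))"
    by (rule of_nat_mono)
  also have "\<dots> = (\<Sum>q\<in>?Q. real (card (?L q)) + real (card (?R q)))"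
    by simp
  also have "\<dots> \<le> (\<Sum>q\<in>?Q. ?e + ?e)"
    by (intro sum_mono add_mono L R)
  also have "\<dots> = 2 * real (card S) ^ 4 * (3/4) ^ (card S - 1) * 2 ^ (card S ^ 3)"
    by (simp add: card_cartesian_product power4_eq_xxxx)
  finally show ?thesis .
qed

lemma fraction_hypergroups_ge:
  assumes "n > 0"
  shows "1 - 2 * real n ^ 4 * (3/4) ^ (n - 1) \<le> real (card (Y' n)) / 2 ^ (n ^ 3)"
proof -
  let ?M = "multioperations (N n)"
  let ?bad = "{m \<in> ?M. \<not> full_triple_products (N n) m}"
  have N: "finite (N n)" "N n \<noteq> {}" "card (N n) = n"
    using assms by (auto simp: N_def)
  have fin: "finite ?M"
    using N(1) by (auto simp: multioperations_def intro!: finite_PiE)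
  have "?M \<subseteq> Y' n \<union> ?bad"
    using full_triple_products_imp_hypergroup [OF N(2)] by (auto simp: Y'_def)
  then have "card ?M \<le> card (Y' n \<union> ?bad)"
    using fin by (intro card_mono) (auto simp: Y'_def)
  also have "\<dots> \<le> card (Y' n) + card ?bad"
    by (rule card_Un_le)
  finally have "real (2 ^ (n ^ 3)) \<le> real (card (Y' n) + card ?bad)"
    unfolding card_multioperations by (rule of_nat_mono)
  then have "(2::real) ^ (n ^ 3) \<le> real (card (Y' n)) + real (card ?bad)"
    by simp
  with card_not_full_triple_products_le [OF N(1)]
  have "(1 - 2 * real n ^ 4 * (3/4) ^ (n - 1)) * 2 ^ (n ^ 3) \<le> real (card (Y' n))"
    unfolding N(3) left_diff_distrib by linarith
  then show ?thesis
    by (simp add: pos_le_divide_eq)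
qed

theorem theorem24:
  shows "(\<lambda>n. real (card (Y n)) / 2 ^ (n ^ 3)) \<longlonglongrightarrow> 1 \<and>
         (\<lambda>n. real (card (Y' n)) / 2 ^ (n ^ 3)) \<longlonglongrightarrow> 1"
proof -
  let ?low = "\<lambda>n. 1 - 2 * real n ^ 4 * (3/4) ^ (n - 1)"
  let ?y = "\<lambda>n. real (card (Y n)) / 2 ^ (n ^ 3)"
  let ?y' = "\<lambda>n. real (card (Y' n)) / 2 ^ (n ^ 3)"
  have fin: "finite (multioperations (N n))" for n
    by (auto simp: multioperations_def N_def intro!: finite_PiE)
  have "card (Y n) \<le> 2 ^ (n ^ 3)" for n
    unfolding card_multioperations [symmetric] using fin by (intro card_mono) (auto simp: Y_def)
  then have "real (card (Y n)) \<le> real (2 ^ (n ^ 3))" for n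
    by (rule of_nat_mono)
  then have y_le: "?y n \<le> 1" for n
    by simp
  have "card (Y' n) \<le> card (Y n)" for n
    using fin [of n] by (intro card_mono) (auto simp: Y_def Y'_def hypergroup_def)
  then have y'_le: "?y' n \<le> ?y n" for n
    by (simp add: divide_right_mono)
  have low_le: "\<forall>\<^sub>F n in sequentially. ?low n \<le> ?y' n"
    using eventually_gt_at_top [of 0] by eventually_elim (rule fraction_hypergroups_ge)
  have low: "?low \<longlonglongrightarrow> 1"
    by real_asymp
  have "?y' \<longlonglongrightarrow> 1"
    using always_eventually [OF allI [OF order_trans [OF y'_le y_le]]]
    by (rule tendsto_sandwich [OF low_le _ low tendsto_const])
  moreover from this have "?y \<longlonglongrightarrow> 1"
    by (rule tendsto_sandwich [OF always_eventually [OF allI [OF y'_le]]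
          always_eventually [OF allI [OF y_le]] _ tendsto_const])
  ultimately show ?thesis
    by blast
qed

end
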